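(* There is an algorithm that, given a set $X$ of $n$ points in the plane and a positive integer $\tau$, reports all $\tau$-ordinary triangles spanned by $X$ in $O(n^3)$ time. The order of magnitude of this bound cannot be improved in the worst case: every algorithm for this reporting problem needs $\Omega(n^3)$ time in the worst case over inputs $(X,\tau)$ with $|X| = n$.
   Context: Let $X$ be a finite set of points in the plane. A line spanned by $X$ is a line passing through at least two points of $X$. For a positive integer $\tau$, a line spanned by $X$ is called $\tau$-ordinary if it is incident to at most $\tau$ points of $X$. Three noncollinear points of $X$ form a $\tau$-ordinary triangle if each of the three lines determined by pairs of these points is $\tau$-ordinary (with respect to $X$). Reporting all $\tau$-ordinary triangles means outputting an explicit list of all unordered triples of points of $X$ that form a $\tau$-ordinary triangle, each listed once. Running time is the number of elementary operations in the standard model of computational geometry (real RAM: points are given by real coordinates, and arithmetic operations, comparisons, memory accesses and output of one triple each take constant time); the constants implied in $O(\cdot)$ and $\Omega(\cdot)$ are absolute. *)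

theory Defs
  imports "HOL-Analysis.Analysis"
begin

section \<open>Ordinary lines and triangles\<close>

type_synonym point = "real \<times> real"

definition is_line :: "point set \<Rightarrow> bool" where
  "is_line L \<longleftrightarrow> (\<exists>p q. p \<noteq> q \<and> L = affine hull {p, q})"

definition spanned_line :: "point set \<Rightarrow> point set \<Rightarrow> bool" where
  "spanned_line X L \<longleftrightarrow> is_line L \<and> (\<exists>p\<in>X \<inter> L. \<exists>q\<in>X \<inter> L. p \<noteq> q)"

definition ordinary_line :: "nat \<Rightarrow> point set \<Rightarrow> point set \<Rightarrow> bool" where
  "ordinary_line \<tau> X L \<longleftrightarrow> spanned_line X L \<and> card (X \<inter> L) \<le> \<tau>"

definition ordinary_triangle :: "nat \<Rightarrow> point set \<Rightarrow> point set \<Rightarrow> bool" where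
  "ordinary_triangle \<tau> X T \<longleftrightarrow>
     T \<subseteq> X \<and> card T = 3 \<and> \<not> collinear T \<and>
     (\<forall>p\<in>T. \<forall>q\<in>T. p \<noteq> q \<longrightarrow> ordinary_line \<tau> X (affine hull {p, q}))"

section \<open>The real RAM\<close>

text \<open>
  A program is a finite list of instructions, each of unit cost. Operands of type \<open>nat\<close>
  are register numbers, except for the jump targets, which are positions in the program.
  Besides the registers there is a memory that is only accessible by indirect addressing.
  All cells hold real numbers; there is no rounding operation, and a real number
  serves as an address only if it is a natural number. Literal constants are integers.
  \<open>Output\<close> takes the coordinates of three points from six registers and reports them as an
  unordered triple.
\<close>

datatype instr =
    Const nat int
  | Move nat nat
  | Add nat nat nat
  | Sub nat nat nat
  | Mul nat nat nat
  | Div nat nat nat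
  | Load nat nat
  | Store nat nat
  | Jump nat
  | JumpLess nat nat nat
  | JumpEq nat nat nat
  | Output nat nat nat nat nat nat
  | Halt

type_synonym program = "instr list"

record config =
  pc :: nat
  regs :: "nat \<Rightarrow> real"
  mem :: "nat \<Rightarrow> real"
  out :: "point set list"

definition set_reg :: "nat \<Rightarrow> real \<Rightarrow> config \<Rightarrow> config" where
  "set_reg r v s = s\<lparr>regs := (regs s)(r := v), pc := Suc (pc s)\<rparr>"

definition jump_if :: "bool \<Rightarrow> nat \<Rightarrow> config \<Rightarrow> config" where
  "jump_if b l s = s\<lparr>pc := (if b then l else Suc (pc s))\<rparr>"

text \<open>
  The result \<open>None\<close> means that there is no next configuration: the machine has halted, or it is
  stuck because of a division by zero or an address that is not a natural number.
\<close>

fun exec_instr :: "instr \<Rightarrow> config \<Rightarrow> config option" where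
  "exec_instr (Const r c) s = Some (set_reg r (of_int c) s)"
| "exec_instr (Move r a) s = Some (set_reg r (regs s a) s)"
| "exec_instr (Add r a b) s = Some (set_reg r (regs s a + regs s b) s)"
| "exec_instr (Sub r a b) s = Some (set_reg r (regs s a - regs s b) s)"
| "exec_instr (Mul r a b) s = Some (set_reg r (regs s a * regs s b) s)"
| "exec_instr (Div r a b) s =
     (if regs s b = 0 then None else Some (set_reg r (regs s a / regs s b) s))"
| "exec_instr (Load r a) s =
     (if regs s a \<in> \<nat> then Some (set_reg r (mem s (nat \<lfloor>regs s a\<rfloor>)) s) else None)"
| "exec_instr (Store a r) s =
     (if regs s a \<in> \<nat>
      then Some (s\<lparr>mem := (mem s)(nat \<lfloor>regs s a\<rfloor> := regs s r), pc := Suc (pc s)\<rparr>)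
      else None)"
| "exec_instr (Jump l) s = Some (jump_if True l s)"
| "exec_instr (JumpLess a b l) s = Some (jump_if (regs s a < regs s b) l s)"
| "exec_instr (JumpEq a b l) s = Some (jump_if (regs s a = regs s b) l s)"
| "exec_instr (Output a b c d e f) s =
     Some (s\<lparr>out := out s @ [{(regs s a, regs s b), (regs s c, regs s d), (regs s e, regs s f)}],
             pc := Suc (pc s)\<rparr>)"
| "exec_instr Halt s = None"

definition step :: "program \<Rightarrow> config \<Rightarrow> config \<Rightarrow> bool" where
  "step P s s' \<longleftrightarrow> pc s < length P \<and> exec_instr (P ! pc s) s = Some s'"

definition halted :: "program \<Rightarrow> config \<Rightarrow> bool" where
  "halted P s \<longleftrightarrow> pc s < length P \<and> P ! pc s = Halt"

text \<open>
  The point set is given as an array listing its elements in arbitrary order. Register 0 holds the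
  number of points, register 1 holds \<open>\<tau>\<close>, and the coordinates of the \<open>i\<close>-th point
  are in the memory cells \<open>2 * i\<close> and \<open>2 * i + 1\<close>. Everything else is initially 0.
\<close>

definition init :: "point list \<Rightarrow> nat \<Rightarrow> config" where
  "init ps \<tau> =
     \<lparr>pc = 0,
      regs = (\<lambda>_. 0)(0 := real (length ps), 1 := real \<tau>),
      mem = (\<lambda>a. if a < 2 * length ps
                 then (if even a then fst (ps ! (a div 2)) else snd (ps ! (a div 2)))
                 else 0),
      out = []\<rparr>"

definition valid_input :: "nat \<Rightarrow> point set \<Rightarrow> point list \<Rightarrow> nat \<Rightarrow> bool" where
  "valid_input n X ps \<tau> \<longleftrightarrow>
     finite X \<and> card X = n \<and> distinct ps \<and> set ps = X \<and> 1 \<le> \<tau>"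

text \<open>
  On the given input the program halts after exactly \<open>t\<close> steps with output \<open>os\<close>; the lemma below
  shows that \<open>t\<close> (the running time) and \<open>os\<close> are unique.
\<close>

definition halts_with :: "program \<Rightarrow> point list \<Rightarrow> nat \<Rightarrow> nat \<Rightarrow> point set list \<Rightarrow> bool" where
  "halts_with P ps \<tau> t os \<longleftrightarrow>
     (\<exists>s. (step P ^^ t) (init ps \<tau>) s \<and> halted P s \<and> out s = os)"

definition reports_ordinary_triangles :: "program \<Rightarrow> bool" where
  "reports_ordinary_triangles P \<longleftrightarrow>
     (\<forall>n X ps \<tau>. valid_input n X ps \<tau> \<longrightarrow>
        (\<exists>t os. halts_with P ps \<tau> t os \<and> distinct os \<and> set os = {T. ordinary_triangle \<tau> X T}))"

lemma step_unique: "step P s s' \<Longrightarrow> step P s s'' \<Longrightarrow> s' = s''"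
  by (simp add: step_def)

lemma halted_no_step: "halted P s \<Longrightarrow> \<not> step P s s'"
  by (simp add: step_def halted_def)

lemma halts_unique:
  "(step P ^^ t) s u \<Longrightarrow> halted P u \<Longrightarrow> (step P ^^ t') s u' \<Longrightarrow> halted P u' \<Longrightarrow> t = t' \<and> u = u'"
proof (induction t arbitrary: s t')
  case 0
  then have "s = u" "\<And>v. \<not> step P s v"
    by (auto dest: halted_no_step)
  with 0 show ?case
    by (cases t') (auto simp del: relpowp.simps(2) dest!: relpowp_Suc_D2)
next
  case (Suc t)
  obtain v where v: "step P s v" "(step P ^^ t) v u"
    using relpowp_Suc_D2[OF Suc.prems(1)] by blast
  show ?case
  proof (cases t')
    case 0
    then show ?thesis
      using Suc.prems v halted_no_step by auto
  next
    case (Suc k)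
    obtain w where w: "step P s w" "(step P ^^ k) w u'"
      using relpowp_Suc_D2 Suc.prems(3) Suc by metis
    have "w = v"
      using step_unique v w by blast
    then show ?thesis
      using Suc.IH[OF v(2) Suc.prems(2), of k] w Suc.prems(4) Suc by simp
  qed
qed

lemma halts_with_unique:
  "halts_with P ps \<tau> t os \<Longrightarrow> halts_with P ps \<tau> t' os' \<Longrightarrow> t = t' \<and> os = os'"
  unfolding halts_with_def using halts_unique by blast

end

theory Submission
  imports Defs
begin

text \<open>
  Upper bound. For every ordered pair of points, count by brute force the points on the line through
  them, and keep the counts in an \<open>n \<times> n\<close> table; this takes cubic time. Afterwards each triple of
  points is tested in constant time, by one orientation test and three table look-ups, and there are
  at most \<open>n ^ 3\<close> triples. A triple is visited only as \<open>i > j > k\<close>, so that no triangle is reported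
  twice. To verify the machine code, it is assembled from relocatable fragments (\<open>block\<close>, \<open>;;\<close>,
  \<open>unless\<close>, \<open>for_loop\<close>), each of which has a proof rule for Hoare triples \<open>triple A c T B\<close> that
  include a bound \<open>T\<close> on the number of steps. The lemma \<open>prog_halts\<close> gives output and time of the
  whole program, and \<open>report_correct\<close> says that this output is what the problem asks for.

  Lower bound. The output itself is too long: among \<open>n\<close> points on a parabola no three are
  collinear, so for \<open>\<tau> = 2\<close> all \<open>n choose 3 \<ge> (n / 3) ^ 3\<close> triples have to be
  reported, and a step reports at most one.
\<close>

section \<open>Timed Hoare triples for relocatable code\<close>

text \<open>
  Jump targets are absolute. A fragment is therefore a function of the address of its first
  instruction.
\<close>

type_synonym code = "nat \<Rightarrow> instr list"

text \<open>
  Assertions do not see the program counter. So they survive jumps, and the same assertion serves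
  a fragment wherever it is placed.
\<close>

type_synonym assertion = "(nat \<Rightarrow> real) \<Rightarrow> (nat \<Rightarrow> real) \<Rightarrow> point set list \<Rightarrow> bool"

definition reaches :: "program \<Rightarrow> nat \<Rightarrow> config \<Rightarrow> nat \<Rightarrow> assertion \<Rightarrow> bool" where
  "reaches P T s l B \<longleftrightarrow>
     (\<exists>t\<le>T. \<exists>s'. (step P ^^ t) s s' \<and> pc s' = l \<and> B (regs s') (mem s') (out s'))"

text \<open>
  Total correctness with a time bound, for the fragment inside an arbitrary program: control enters at
  its first instruction and leaves to the position just behind its last one.
\<close>

definition triple :: "assertion \<Rightarrow> code \<Rightarrow> nat \<Rightarrow> assertion \<Rightarrow> bool" where
  "triple A c T B \<longleftrightarrow>
     (\<forall>pre post s. pc s = length pre \<longrightarrow> A (regs s) (mem s) (out s) \<longrightarrow>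
        reaches (pre @ c (length pre) @ post) T s (length pre + length (c (length pre))) B)"

lemma reaches_here: "pc s = l \<Longrightarrow> B (regs s) (mem s) (out s) \<Longrightarrow> reaches P T s l B"
  unfolding reaches_def by (intro exI[of _ 0]) auto

lemma reaches_step:
  assumes "step P s s'" "reaches P T s' l B"
  shows "reaches P (Suc T) s l B"
proof -
  obtain t u where "t \<le> T" "(step P ^^ t) s' u" "pc u = l" "B (regs u) (mem u) (out u)"
    using assms(2) unfolding reaches_def by blast
  then show ?thesis
    unfolding reaches_def using assms(1)
    by (intro exI[of _ "Suc t"]) (auto simp del: relpowp.simps intro: relpowp_Suc_I2)
qed

lemma reaches_trans:
  assumes "reaches P T s l B"
    and "\<And>s'. pc s' = l \<Longrightarrow> B (regs s') (mem s') (out s') \<Longrightarrow> reaches P T' s' l' B'"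
  shows "reaches P (T + T') s l' B'"
proof -
  obtain t u where u: "t \<le> T" "(step P ^^ t) s u" "pc u = l" "B (regs u) (mem u) (out u)"
    using assms(1) unfolding reaches_def by blast
  obtain t' v where v: "t' \<le> T'" "(step P ^^ t') u v" "pc v = l'" "B' (regs v) (mem v) (out v)"
    using assms(2)[OF u(3,4)] unfolding reaches_def by blast
  have "(step P ^^ (t + t')) s v"
    using u(2) v(2) by (auto simp: relpowp_add)
  then show ?thesis
    unfolding reaches_def using u(1) v by (intro exI[of _ "t + t'"]) auto
qed

lemma reaches_mono: "reaches P T s l B \<Longrightarrow> T \<le> T' \<Longrightarrow> reaches P T' s l B"
  unfolding reaches_def using order_trans by blast

lemma tripleI:
  assumes "\<And>pre post s. pc s = length pre \<Longrightarrow> A (regs s) (mem s) (out s) \<Longrightarrow>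
     reaches (pre @ c (length pre) @ post) T s (length pre + length (c (length pre))) B"
  shows "triple A c T B"
  using assms unfolding triple_def by blast

lemma tripleD:
  assumes "triple A c T B" "A (regs s) (mem s) (out s)" "pc s = l"
    and "P = pre @ c l @ post" "length pre = l" "l' = l + length (c l)"
  shows "reaches P T s l' B"
  using assms unfolding triple_def by metis

lemma triple_mono: "triple A c T B \<Longrightarrow> T \<le> T' \<Longrightarrow> triple A c T' B"
  unfolding triple_def using reaches_mono by blast

lemma triple_pre:
  "triple A c T B \<Longrightarrow> (\<And>R M os. A' R M os \<Longrightarrow> A R M os) \<Longrightarrow> triple A' c T B"
  unfolding triple_def by blast

lemma triple_post:
  "triple A c T B \<Longrightarrow> (\<And>R M os. B R M os \<Longrightarrow> B' R M os) \<Longrightarrow> triple A c T B'"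
  unfolding triple_def reaches_def by meson

text \<open>
  Execution without jumps, as a function that the simplifier can evaluate. The test of the
  program counter lets a block fail when it jumps to anywhere but the next instruction.
\<close>

fun run_block :: "instr list \<Rightarrow> config \<Rightarrow> config option" where
  "run_block [] s = Some s"
| "run_block (i # is) s = (case exec_instr i s of
      None \<Rightarrow> None
    | Some s' \<Rightarrow> if pc s' = Suc (pc s) then run_block is s' else None)"

lemma run_block_append:
  "run_block (is @ js) s = (case run_block is s of None \<Rightarrow> None | Some s' \<Rightarrow> run_block js s')"
  by (induction "is" arbitrary: s) (auto split: option.splits)

definition block :: "instr list \<Rightarrow> code" where
  "block is l = is"

definition seq :: "code \<Rightarrow> code \<Rightarrow> code" (infixr ";;" 60) where
  "(c ;; d) l = c l @ d (l + length (c l))"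

text \<open>The instruction \<open>jmp l\<close> is a conditional jump to \<open>l\<close>; here it skips \<open>c\<close>.\<close>

definition unless :: "(nat \<Rightarrow> instr) \<Rightarrow> code \<Rightarrow> code" where
  "unless jmp c l = jmp (l + 1 + length (c (l + 1))) # c (l + 1)"

text \<open>
  The roles of the registers: \<open>rI\<close>, \<open>rJ\<close>, \<open>rK\<close> are loop counters, \<open>rOne\<close> holds the constant 1,
  and \<open>rBase\<close> the address \<open>2 * n\<close> of the table, which lies directly behind the input.
\<close>

abbreviation (input) "rN \<equiv> 0 :: nat"
abbreviation (input) "rTau \<equiv> 1 :: nat"
abbreviation (input) "rI \<equiv> 2 :: nat"
abbreviation (input) "rJ \<equiv> 3 :: nat"
abbreviation (input) "rK \<equiv> 4 :: nat"
abbreviation (input) "rOne \<equiv> 5 :: nat"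
abbreviation (input) "rBase \<equiv> 6 :: nat"
abbreviation (input) "rXi \<equiv> 7 :: nat"
abbreviation (input) "rYi \<equiv> 8 :: nat"
abbreviation (input) "rXj \<equiv> 9 :: nat"
abbreviation (input) "rYj \<equiv> 10 :: nat"
abbreviation (input) "rXk \<equiv> 11 :: nat"
abbreviation (input) "rYk \<equiv> 12 :: nat"
abbreviation (input) "rCount \<equiv> 13 :: nat"
abbreviation (input) "rA \<equiv> 14 :: nat"
abbreviation (input) "rB \<equiv> 15 :: nat"
abbreviation (input) "rC \<equiv> 16 :: nat"
abbreviation (input) "rAddr \<equiv> 17 :: nat"

text \<open>
  The counter \<open>r\<close> runs from 0 until it equals the register \<open>m\<close>. Behind the two header instructions
  the body starts at \<open>l + 2\<close>; the exit lies behind the increment and the jump back to the test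
  at \<open>l + 1\<close>.
\<close>

definition for_loop :: "nat \<Rightarrow> nat \<Rightarrow> code \<Rightarrow> code" where
  "for_loop r m c l =
     [Const r 0, JumpEq r m (l + 4 + length (c (l + 2)))] @ c (l + 2) @
     [Add r r rOne, Jump (l + 1)]"

lemma reaches_block:
  assumes "run_block is s = Some s'" "pc s = length pre" "B (regs s') (mem s') (out s')"
  shows "reaches (pre @ is @ post) (length is) s (length pre + length is) B"
  using assms
proof (induction "is" arbitrary: s pre)
  case Nil
  then show ?case by (auto intro: reaches_here)
next
  case (Cons i "is")
  obtain u where u: "exec_instr i s = Some u" "pc u = Suc (pc s)" "run_block is u = Some s'"
    using Cons.prems(1) by (auto split: option.splits if_splits)
  have "step (pre @ (i # is) @ post) s u"
    using u Cons.prems(2) by (simp add: step_def)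
  moreover have "reaches (pre @ (i # is) @ post) (length is) u (length pre + length (i # is)) B"
    using Cons.IH[OF u(3), of "pre @ [i]"] Cons.prems(2,3) u(2) by simp
  ultimately show ?case
    by (auto intro: reaches_step)
qed

lemma triple_block:
  assumes "\<And>s. A (regs s) (mem s) (out s) \<Longrightarrow>
             \<exists>s'. run_block is s = Some s' \<and> B (regs s') (mem s') (out s')"
  shows "triple A (block is) (length is) B"
proof (rule tripleI)
  fix pre post :: "instr list" and s :: config
  assume s: "pc s = length pre" "A (regs s) (mem s) (out s)"
  then obtain s' where "run_block is s = Some s'" "B (regs s') (mem s') (out s')"
    using assms by blast
  then show "reaches (pre @ block is (length pre) @ post) (length is) s
               (length pre + length (block is (length pre))) B"
    using s reaches_block by (simp add: block_def)
qed

lemma triple_seq: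
  assumes "triple A c T B" "triple B d T' C"
  shows "triple A (c ;; d) (T + T') C"
proof (rule tripleI)
  fix pre post :: "instr list" and s :: config
  assume s: "pc s = length pre" "A (regs s) (mem s) (out s)"
  let ?l = "length pre"
  let ?P = "pre @ (c ;; d) ?l @ post"
  have "reaches ?P T s (?l + length (c ?l)) B"
    by (rule tripleD[OF assms(1) s(2,1), where pre = pre
          and post = "d (?l + length (c ?l)) @ post"]) (simp_all add: seq_def)
  then show "reaches ?P (T + T') s (?l + length ((c ;; d) ?l)) C"
  proof (rule reaches_trans)
    fix u :: config assume u: "pc u = ?l + length (c ?l)" "B (regs u) (mem u) (out u)"
    show "reaches ?P T' u (?l + length ((c ;; d) ?l)) C"
      by (rule tripleD[OF assms(2) u(2,1), where pre = "pre @ c ?l" and post = post])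
         (simp_all add: seq_def)
  qed
qed

text \<open>
  The truth value \<open>\<phi>\<close> of the test is a proposition independent of the machine state: in
  all uses it is determined by the input and the loop indices, and each branch may use it
  as a mathematical fact.
\<close>

lemma triple_unless:
  assumes jmp: "\<And>l s. exec_instr (jmp l) s = Some (jump_if (b (regs s)) l s)"
    and test: "\<And>R M os. A R M os \<Longrightarrow> b R \<longleftrightarrow> \<phi>"
    and go: "\<not> \<phi> \<Longrightarrow> triple A c T B"
    and skip: "\<And>R M os. \<phi> \<Longrightarrow> A R M os \<Longrightarrow> B R M os"
  shows "triple A (unless jmp c) (Suc T) B"
proof (rule tripleI)
  fix pre post :: "instr list" and s :: config
  assume s: "pc s = length pre" "A (regs s) (mem s) (out s)"
  let ?l = "length pre"
  let ?P = "pre @ unless jmp c ?l @ post"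
  let ?e = "?l + length (unless jmp c ?l)"
  let ?u = "jump_if (b (regs s)) ?e s"
  have "reaches ?P T ?u ?e B"
  proof (cases \<phi>)
    case True
    then show ?thesis
      using skip test s by (intro reaches_here) (auto simp: jump_if_def)
  next
    case False
    show ?thesis
      by (rule tripleD[OF go[OF False], where pre = "pre @ [jmp ?e]" and post = post and l = "?l + 1"])
         (use False test s in \<open>auto simp: jump_if_def unless_def\<close>)
  qed
  moreover have "step ?P s ?u"
    using s by (simp add: step_def jmp unless_def nth_append)
  ultimately show "reaches ?P (Suc T) s ?e B"
    by (rule reaches_step[rotated])
qed

text \<open>
  The invariant \<open>I i\<close> holds at the loop test, hence the body must establish \<open>I (Suc i)\<close> for
  the registers after the increment that follows it. Each round costs the body and the three
  instructions test, increment and jump; the initialisation and the final test add 2.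
\<close>

lemma triple_for_loop:
  assumes start: "\<And>R M os. A R M os \<Longrightarrow> I 0 (R(r := 0)) M os"
    and cnt: "\<And>i R M os. I i R M os \<Longrightarrow> R r = real i \<and> R m = real n"
    and body: "\<And>i. i < n \<Longrightarrow>
          triple (I i) c T (\<lambda>R M os. I (Suc i) (R(r := R r + R rOne)) M os)"
    and exit: "\<And>R M os. I n R M os \<Longrightarrow> B R M os"
  shows "triple A (for_loop r m c) (n * (T + 3) + 2) B"
proof (rule tripleI)
  fix pre post :: "instr list" and s :: config
  assume s: "pc s = length pre" "A (regs s) (mem s) (out s)"
  let ?l = "length pre"
  let ?P = "pre @ for_loop r m c ?l @ post"
  let ?e = "?l + length (for_loop r m c ?l)"
  have loop: "reaches ?P ((n - i) * (T + 3) + 1) u ?e B"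
    if "i \<le> n" "pc u = ?l + 1" "I i (regs u) (mem u) (out u)" for i u
    using that
  proof (induction i arbitrary: u rule: inc_induct)
    case base
    have "step ?P u (jump_if True ?e u)"
      using cnt[OF base(2)] base(1) by (simp add: step_def for_loop_def nth_append eval_nat_numeral)
    moreover have "reaches ?P 0 (jump_if True ?e u) ?e B"
      using exit[OF base(2)] by (intro reaches_here) (simp_all add: jump_if_def)
    ultimately show ?case
      using reaches_step by fastforce
  next
    case (step i)
    let ?v = "jump_if False ?e u"
    let ?J = "\<lambda>R M os. I (Suc i) (R(r := R r + R rOne)) M os"
    let ?k = "?l + 2 + length (c (?l + 2))"
    have 1: "step ?P u ?v"
      using cnt[OF step(5)] step(4) \<open>i < n\<close>
      by (simp add: step_def for_loop_def nth_append eval_nat_numeral)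
    have 2: "reaches ?P T ?v ?k ?J"
      by (rule tripleD[OF body[OF \<open>i < n\<close>], where pre = "pre @ [Const r 0, JumpEq r m ?e]"
            and post = "[Add r r rOne, Jump (?l + 1)] @ post" and l = "?l + 2"])
         (use step in \<open>simp_all add: jump_if_def for_loop_def\<close>)
    have 3: "reaches ?P (2 + ((n - Suc i) * (T + 3) + 1)) w ?e B"
      if w: "pc w = ?k" "?J (regs w) (mem w) (out w)" for w
    proof -
      let ?x = "set_reg r (regs w r + regs w rOne) w"
      let ?y = "jump_if True (?l + 1) ?x"
      have "step ?P w ?x"
        using w by (simp add: step_def for_loop_def nth_append)
      moreover have "step ?P ?x ?y"
        using w by (simp add: step_def for_loop_def nth_append set_reg_def)
      moreover have "reaches ?P ((n - Suc i) * (T + 3) + 1) ?y ?e B"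
        using w by (intro step.IH) (simp_all add: set_reg_def jump_if_def fun_upd_def)
      ultimately show ?thesis
        using reaches_step by (metis add_2_eq_Suc)
    qed
    have "reaches ?P (Suc (T + (2 + ((n - Suc i) * (T + 3) + 1)))) u ?e B"
      by (rule reaches_step[OF 1 reaches_trans[OF 2 3]])
    moreover have "Suc (T + (2 + ((n - Suc i) * (T + 3) + 1))) = (n - i) * (T + 3) + 1"
      using \<open>i < n\<close> by (simp add: Suc_diff_Suc[symmetric])
    ultimately show ?case by simp
  qed
  let ?u = "set_reg r 0 s"
  have "step ?P s ?u"
    using s by (simp add: step_def for_loop_def)
  moreover have "reaches ?P (n * (T + 3) + 1) ?u ?e B"
    using loop[of 0 ?u] start s by (simp add: set_reg_def)
  ultimately show "reaches ?P (n * (T + 3) + 2) s ?e B"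
    using reaches_step by fastforce
qed

section \<open>The algorithm\<close>

definition load_point :: "nat \<Rightarrow> nat \<Rightarrow> nat \<Rightarrow> instr list" where
  "load_point a x y = [Add rAddr a a, Load x rAddr, Add rAddr rAddr rOne, Load y rAddr]"

text \<open>
  The two products of the cross product of \<open>p\<^sub>j - p\<^sub>i\<close> and \<open>p\<^sub>k - p\<^sub>i\<close> are left in \<open>rA\<close> and \<open>rB\<close>; they agree
  iff the cross product vanishes.
\<close>

definition orientation :: "instr list" where
  "orientation = load_point rI rXi rYi @ load_point rJ rXj rYj @ load_point rK rXk rYk @
     [Sub rA rXj rXi, Sub rB rYk rYi, Mul rA rA rB,
      Sub rB rYj rYi, Sub rC rXk rXi, Mul rB rB rC]"

text \<open>Address of the entry for the indices in \<open>a\<close> and \<open>b\<close> of the table stored by rows.\<close>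

definition cell :: "nat \<Rightarrow> nat \<Rightarrow> instr list" where
  "cell a b = [Mul rAddr a rN, Add rAddr rAddr b, Add rAddr rAddr rBase]"

text \<open>
  Every point is counted first and uncounted if it is off the line, because the conditional
  skips its body on equality.
\<close>

definition count_line :: code where
  "count_line = for_loop rK rN (
     block (orientation @ [Add rCount rCount rOne]) ;;
     unless (JumpEq rA rB) (block [Sub rCount rCount rOne]))"

definition count_phase :: code where
  "count_phase = for_loop rI rN (for_loop rJ rN (
     block [Const rCount 0] ;; count_line ;; block (cell rI rJ @ [Store rAddr rCount])))"

definition unless_heavy :: "nat \<Rightarrow> nat \<Rightarrow> code \<Rightarrow> code" where
  "unless_heavy a b c = block (cell a b @ [Load rA rAddr]) ;; unless (JumpLess rTau rA) c"

definition test_and_report :: code where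
  "test_and_report = block orientation ;; unless (JumpEq rA rB) (
     unless_heavy rI rJ (unless_heavy rI rK (unless_heavy rJ rK (
       block [Output rXi rYi rXj rYj rXk rYk]))))"

definition report_phase :: code where
  "report_phase = for_loop rI rN (for_loop rJ rI (for_loop rK rJ test_and_report))"

definition prog :: code where
  "prog = block [Const rOne 1, Add rBase rN rN] ;; count_phase ;; report_phase"

section \<open>Correctness and running time of the program\<close>

definition on_line :: "point \<Rightarrow> point \<Rightarrow> point \<Rightarrow> bool" where
  "on_line p q r \<longleftrightarrow>
     (fst q - fst p) * (snd r - snd p) = (snd q - snd p) * (fst r - fst p)"

definition line_count :: "point list \<Rightarrow> nat \<Rightarrow> nat \<Rightarrow> nat" where
  "line_count ps i j = card {k. k < length ps \<and> on_line (ps ! i) (ps ! j) (ps ! k)}"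

fun light_triple :: "point list \<Rightarrow> nat \<Rightarrow> nat \<times> nat \<times> nat \<Rightarrow> bool" where
  "light_triple ps \<tau> (i, j, k) \<longleftrightarrow> \<not> on_line (ps ! i) (ps ! j) (ps ! k) \<and>
     line_count ps i j \<le> \<tau> \<and> line_count ps i k \<le> \<tau> \<and> line_count ps j k \<le> \<tau>"

fun corners :: "point list \<Rightarrow> nat \<times> nat \<times> nat \<Rightarrow> point set" where
  "corners ps (i, j, k) = {ps ! i, ps ! j, ps ! k}"

text \<open>
  The index triples that the three nested loops of the second phase have visited when they reach
  \<open>(i, j, k)\<close>, in the order of the visits.
\<close>

definition triples_below :: "nat \<Rightarrow> nat \<Rightarrow> nat \<Rightarrow> (nat \<times> nat \<times> nat) list" where
  "triples_below i j k =
     [(i', j', k'). i' \<leftarrow> [0..<i], j' \<leftarrow> [0..<i'], k' \<leftarrow> [0..<j']] @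
     [(i, j', k'). j' \<leftarrow> [0..<j], k' \<leftarrow> [0..<j']] @
     [(i, j, k'). k' \<leftarrow> [0..<k]]"

text \<open>One equation for the start, and one for each of the three loops going on to its next round.\<close>

lemma triples_below_simps [simp]:
  "triples_below 0 0 0 = []"
  "triples_below i j (Suc k) = triples_below i j k @ [(i, j, k)]"
  "triples_below i (Suc j) 0 = triples_below i j j"
  "triples_below (Suc i) 0 0 = triples_below i i 0"
  by (simp_all add: triples_below_def)

definition report :: "point list \<Rightarrow> nat \<Rightarrow> (nat \<times> nat \<times> nat) list \<Rightarrow> point set list" where
  "report ps \<tau> ts = map (corners ps) (filter (light_triple ps \<tau>) ts)"

text \<open>
  The invariant part of the state: the constants, the input points, and the first \<open>N\<close> entries of
  the table.
\<close>

definition stored :: "point list \<Rightarrow> nat \<Rightarrow> nat \<Rightarrow> (nat \<Rightarrow> real) \<Rightarrow> (nat \<Rightarrow> real) \<Rightarrow> bool" where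
  "stored ps \<tau> N R M \<longleftrightarrow>
     R rN = real (length ps) \<and> R rTau = real \<tau> \<and> R rOne = 1 \<and> R rBase = real (2 * length ps) \<and>
     (\<forall>i<length ps. M (2 * i) = fst (ps ! i) \<and> M (2 * i + 1) = snd (ps ! i)) \<and>
     (\<forall>a<N. M (2 * length ps + a) =
        real (line_count ps (a div length ps) (a mod length ps)))"

lemma stored_upd:
  assumes "stored ps \<tau> N R M" "r \<notin> {rN, rTau, rOne, rBase}"
  shows "stored ps \<tau> N (R(r := v)) M"
  using assms by (simp add: stored_def)

lemma stored_Suc:
  assumes "stored ps \<tau> N R M"
    and "v = real (line_count ps (N div length ps) (N mod length ps))"
  shows "stored ps \<tau> (Suc N) R (M(2 * length ps + N := v))"
  using assms by (auto simp: stored_def less_Suc_eq)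

lemma run_load_point:
  assumes "regs s a = real i" "regs s rOne = 1" "x \<notin> {a, rOne, rAddr}" "y \<notin> {x, rAddr}"
  shows "run_block (load_point a x y) s = Some (s\<lparr>
     regs := (regs s)(x := mem s (2 * i), rAddr := real (2 * i + 1), y := mem s (2 * i + 1)),
     pc := Suc (Suc (Suc (Suc (pc s))))\<rparr>)"
proof -
  have 1: "real i + real i = real (2 * i)" "real (2 * i) + 1 = real (2 * i + 1)"
    by simp_all
  show ?thesis
    using assms by (auto simp: load_point_def set_reg_def 1 simp del: of_nat_add of_nat_mult of_nat_Suc)
qed

lemma run_orientation:
  assumes "stored ps \<tau> N (regs s) (mem s)"
    and "regs s rI = real i" "regs s rJ = real j" "regs s rK = real k"
    and "i < length ps" "j < length ps" "k < length ps"
  obtains s' where "run_block orientation s = Some s'" "mem s' = mem s" "out s' = out s"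
    "stored ps \<tau> N (regs s') (mem s)"
    "\<And>r. r \<in> {rI, rJ, rK, rCount} \<Longrightarrow> regs s' r = regs s r"
    "(regs s' rXi, regs s' rYi) = ps ! i" "(regs s' rXj, regs s' rYj) = ps ! j"
    "(regs s' rXk, regs s' rYk) = ps ! k"
    "regs s' rA = regs s' rB \<longleftrightarrow> on_line (ps ! i) (ps ! j) (ps ! k)"
proof -
  have M: "mem s (2 * a) = fst (ps ! a)" "mem s (Suc (2 * a)) = snd (ps ! a)"
    if "a < length ps" for a
    using assms(1) that by (auto simp: stored_def)
  have one: "regs s rOne = 1"
    using assms(1) by (simp add: stored_def)
  have "\<exists>s'. run_block orientation s = Some s' \<and> mem s' = mem s \<and> out s' = out s \<and>
    stored ps \<tau> N (regs s') (mem s) \<and>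
    (\<forall>r\<in>{rI, rJ, rK, rCount}. regs s' r = regs s r) \<and>
    (regs s' rXi, regs s' rYi) = ps ! i \<and> (regs s' rXj, regs s' rYj) = ps ! j \<and>
    (regs s' rXk, regs s' rYk) = ps ! k \<and>
    (regs s' rA = regs s' rB \<longleftrightarrow> on_line (ps ! i) (ps ! j) (ps ! k))"
    using assms one
    by (simp add: orientation_def run_block_append run_load_point M set_reg_def on_line_def stored_upd)
  then show ?thesis
    using that by blast
qed

lemma run_cell:
  assumes "stored ps \<tau> N (regs s) M" "regs s a = real i" "regs s b = real j" "rAddr \<notin> {a, b}"
  shows "run_block (cell a b) s = Some (s\<lparr>
     regs := (regs s)(rAddr := real (2 * length ps + (i * length ps + j))),
     pc := Suc (Suc (Suc (pc s)))\<rparr>)"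
  using assms by (simp add: cell_def set_reg_def stored_def algebra_simps)

lemma card_less_Suc_Collect:
  "card {m. m < Suc k \<and> Q m} = card {m. m < k \<and> Q m} + (if Q k then 1 else 0)"
proof -
  have "{m. m < Suc k \<and> Q m} = {m. m < k \<and> Q m} \<union> (if Q k then {k} else {})"
    by (auto simp: less_Suc_eq)
  then show ?thesis
    by simp
qed

lemma length_orientation: "length orientation = 18"
  by (simp add: orientation_def load_point_def)

text \<open>The time 21 per point: 19 straight-line instructions, the test, and one subtraction.\<close>

lemma triple_count_line:
  fixes ps :: "point list" and \<tau> N i j :: nat
  defines "n \<equiv> length ps"
  defines "A \<equiv> \<lambda>R M os. stored ps \<tau> N R M \<and> R rI = real i \<and> R rJ = real j \<and> os = []"
  assumes "i < n" "j < n"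
  shows "triple (\<lambda>R M os. A R M os \<and> R rCount = 0) count_line
    (n * (21 + 3) + 2)
    (\<lambda>R M os. A R M os \<and> R rCount = real (line_count ps i j))"
proof -
  define I where "I = (\<lambda>k R M os. A R M os \<and> R rK = real k \<and>
     R rCount = real (card {m. m < k \<and> on_line (ps ! i) (ps ! j) (ps ! m)}))"
  have body: "triple (I k)
      (block (orientation @ [Add rCount rCount rOne]) ;;
       unless (JumpEq rA rB) (block [Sub rCount rCount rOne])) 21
      (\<lambda>R M os. I (Suc k) (R(rK := R rK + R rOne)) M os)" if "k < n" for k
  proof -
    let ?on = "on_line (ps ! i) (ps ! j) (ps ! k)"
    \<comment> \<open>after the addition the counter exceeds its invariant value by one\<close>
    let ?J = "\<lambda>R M os. I k (R(rCount := R rCount - 1)) M os \<and> (R rA = R rB \<longleftrightarrow> ?on)"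
    have "triple (I k) (block (orientation @ [Add rCount rCount rOne]))
            (length (orientation @ [Add rCount rCount rOne])) ?J"
    proof (rule triple_block)
      fix s :: config assume s: "I k (regs s) (mem s) (out s)"
      then have pre: "stored ps \<tau> N (regs s) (mem s)"
          "regs s rI = real i" "regs s rJ = real j" "regs s rK = real k"
        by (simp_all add: I_def A_def)
      have len: "i < length ps" "j < length ps" "k < length ps"
        using assms that by (simp_all add: n_def)
      from run_orientation[OF pre len] obtain u where
        u: "run_block orientation s = Some u" "mem u = mem s" "out u = out s"
        "stored ps \<tau> N (regs u) (mem s)"
        "\<And>r. r \<in> {rI, rJ, rK, rCount} \<Longrightarrow> regs u r = regs s r"
        "regs u rA = regs u rB \<longleftrightarrow> ?on"
        by blast
      then show "\<exists>s'. run_block (orientation @ [Add rCount rCount rOne]) s = Some s' \<and>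
          ?J (regs s') (mem s') (out s')"
        using s by (auto simp: run_block_append set_reg_def I_def A_def stored_def)
    qed
    moreover have "triple ?J (unless (JumpEq rA rB) (block [Sub rCount rCount rOne])) (Suc 1)
        (\<lambda>R M os. I (Suc k) (R(rK := R rK + R rOne)) M os)"
    proof (rule triple_unless[where b = "\<lambda>R. R rA = R rB" and \<phi> = ?on])
      assume "\<not> ?on"
      then have "triple ?J (block [Sub rCount rCount rOne]) (length [Sub rCount rCount rOne])
        (\<lambda>R M os. I (Suc k) (R(rK := R rK + R rOne)) M os)"
        by (intro triple_block)
           (auto simp: set_reg_def I_def A_def card_less_Suc_Collect stored_def)
      then show "triple ?J (block [Sub rCount rCount rOne]) 1
        (\<lambda>R M os. I (Suc k) (R(rK := R rK + R rOne)) M os)"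
        by simp
    qed (auto simp: I_def A_def card_less_Suc_Collect stored_def)
    ultimately have "triple (I k)
      (block (orientation @ [Add rCount rCount rOne]) ;;
       unless (JumpEq rA rB) (block [Sub rCount rCount rOne]))
      (length (orientation @ [Add rCount rCount rOne]) + Suc 1)
      (\<lambda>R M os. I (Suc k) (R(rK := R rK + R rOne)) M os)"
      by (rule triple_seq)
    then show ?thesis
      by (simp add: length_orientation eval_nat_numeral)
  qed
  show ?thesis
    unfolding count_line_def
    by (rule triple_for_loop[where I = I and n = n])
       (use body in \<open>auto simp: I_def A_def stored_def n_def line_count_def\<close>)
qed

lemma
  fixes i j n :: nat
  assumes "i < n" "j < n"
  shows row_major_less: "i * n + j < n * n"
    and row_major_div: "(i * n + j) div n = i"
    and row_major_mod: "(i * n + j) mod n = j"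
proof -
  have "i * n + j < Suc i * n"
    using assms by simp
  also have "\<dots> \<le> n * n"
    using assms by (intro mult_le_mono1) simp
  finally show "i * n + j < n * n" .
qed (use assms in auto)

text \<open>
  The table is filled in the order of its addresses, so at the start of round \<open>(i, j)\<close> exactly
  the first \<open>i * n + j\<close> entries are known.
\<close>

lemma triple_count_phase:
  fixes ps :: "point list"
  defines "n \<equiv> length ps"
  shows "triple (\<lambda>R M os. stored ps \<tau> 0 R M \<and> os = []) count_phase
    (n * (n * (1 + (n * (21 + 3) + 2) + 4 + 3) + 2 + 3) + 2)
    (\<lambda>R M os. stored ps \<tau> (n * n) R M \<and> os = [])"
proof -
  define A :: "nat \<Rightarrow> nat \<Rightarrow> assertion" where
    "A = (\<lambda>i j R M os. stored ps \<tau> (i * n + j) R M \<and> R rI = real i \<and> R rJ = real j \<and> os = [])"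
  have line: "triple (A i j)
      (block [Const rCount 0] ;; count_line ;; block (cell rI rJ @ [Store rAddr rCount]))
      (1 + (n * (21 + 3) + 2) + 4)
      (\<lambda>R M os. A i (Suc j) (R(rJ := R rJ + R rOne)) M os)" if "i < n" "j < n" for i j
  proof -
    have "triple (A i j) (block [Const rCount 0]) (length [Const rCount 0])
        (\<lambda>R M os. A i j R M os \<and> R rCount = 0)"
      by (rule triple_block) (auto simp: A_def set_reg_def stored_def)
    moreover have "triple (\<lambda>R M os. A i j R M os \<and> R rCount = 0) count_line (n * (21 + 3) + 2)
        (\<lambda>R M os. A i j R M os \<and> R rCount = real (line_count ps i j))"
      using triple_count_line[of i ps j \<tau> "i * n + j"] that by (simp add: A_def n_def)
    moreover have "triple (\<lambda>R M os. A i j R M os \<and> R rCount = real (line_count ps i j))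
        (block (cell rI rJ @ [Store rAddr rCount])) (length (cell rI rJ @ [Store rAddr rCount]))
        (\<lambda>R M os. A i (Suc j) (R(rJ := R rJ + R rOne)) M os)"
    proof (rule triple_block)
      fix s :: config
      assume s: "A i j (regs s) (mem s) (out s) \<and> regs s rCount = real (line_count ps i j)"
      have "(i * n + j) div n = i" "(i * n + j) mod n = j"
        using that by (simp_all only: row_major_div row_major_mod)
      then have "stored ps \<tau> (Suc (i * n + j)) (regs s)
          ((mem s)(2 * n + (i * n + j) := regs s rCount))"
        using s stored_Suc[of ps \<tau> "i * n + j" "regs s" "mem s"] by (simp add: A_def n_def)
      then show "\<exists>s'. run_block (cell rI rJ @ [Store rAddr rCount]) s = Some s' \<and>
          A i (Suc j) ((regs s')(rJ := regs s' rJ + regs s' rOne)) (mem s') (out s')"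
        using s run_cell[of ps \<tau> "i * n + j" s "mem s" rI i rJ j]
        by (auto simp: A_def run_block_append n_def stored_def simp del: of_nat_add of_nat_mult)
    qed
    ultimately have "triple (A i j)
      (block [Const rCount 0] ;; count_line ;; block (cell rI rJ @ [Store rAddr rCount]))
      (length [Const rCount 0] + (n * (21 + 3) + 2 + length (cell rI rJ @ [Store rAddr rCount])))
      (\<lambda>R M os. A i (Suc j) (R(rJ := R rJ + R rOne)) M os)"
      by (intro triple_seq)
    then show ?thesis
      by (simp add: cell_def eval_nat_numeral)
  qed
  have row: "triple (\<lambda>R M os. A i 0 (R(rJ := 0)) M os)
      (for_loop rJ rN (block [Const rCount 0] ;; count_line ;; block (cell rI rJ @ [Store rAddr rCount])))
      (n * (1 + (n * (21 + 3) + 2) + 4 + 3) + 2)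
      (\<lambda>R M os. A (Suc i) 0 (R(rI := R rI + R rOne, rJ := 0)) M os)" if "i < n" for i
    by (rule triple_for_loop[where I = "A i" and n = n])
       (use line that in \<open>auto simp: A_def stored_def n_def algebra_simps\<close>)
  show ?thesis
    unfolding count_phase_def
    by (rule triple_for_loop[where I = "\<lambda>i R M os. A i 0 (R(rJ := 0)) M os" and n = n])
       (use row in \<open>auto simp: A_def stored_def n_def\<close>)
qed

text \<open>
  The look-up overwrites only the registers \<open>rAddr\<close> and \<open>rA\<close>; an assertion that ignores them
  holds at \<open>c\<close> just as before. As the count is a function of the indices, \<open>c\<close> has to be
  treated only if the line is light.
\<close>

lemma triple_unless_heavy:
  assumes A: "\<And>R M os. A R M os \<Longrightarrow>
        stored ps \<tau> (length ps * length ps) R M \<and> R a = real i \<and> R b = real j"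
    and frame: "\<And>R M os u v. A R M os \<Longrightarrow> A (R(rAddr := u, rA := v)) M os"
    and ij: "i < length ps" "j < length ps" and ab: "rAddr \<notin> {a, b}"
    and light: "line_count ps i j \<le> \<tau> \<Longrightarrow> triple A c T B"
    and heavy: "\<And>R M os. \<tau> < line_count ps i j \<Longrightarrow> A R M os \<Longrightarrow> B R M os"
  shows "triple A (unless_heavy a b c) (T + 5) B"
proof -
  let ?n = "length ps"
  let ?J = "\<lambda>R M os. A R M os \<and> R rA = real (line_count ps i j)"
  have "triple A (block (cell a b @ [Load rA rAddr])) (length (cell a b @ [Load rA rAddr])) ?J"
  proof (rule triple_block)
    fix s :: config assume s: "A (regs s) (mem s) (out s)"
    have "i * ?n + j < ?n * ?n"
      using ij by (rule row_major_less)
    moreover have "(i * ?n + j) div ?n = i" "(i * ?n + j) mod ?n = j"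
      using ij by (simp_all only: row_major_div row_major_mod)
    ultimately have "mem s (2 * ?n + (i * ?n + j)) = real (line_count ps i j)"
      using A[OF s] by (auto simp: stored_def)
    then show "\<exists>s'. run_block (cell a b @ [Load rA rAddr]) s = Some s' \<and>
        ?J (regs s') (mem s') (out s')"
      using A[OF s] s run_cell[of ps \<tau> "?n * ?n" s "mem s" a i b j] ab frame
      by (auto simp: run_block_append set_reg_def simp del: of_nat_add of_nat_mult)
  qed
  moreover have "triple ?J (unless (JumpLess rTau rA) c) (Suc T) B"
  proof (rule triple_unless[where b = "\<lambda>R. R rTau < R rA" and \<phi> = "\<tau> < line_count ps i j"])
    assume "\<not> \<tau> < line_count ps i j"
    then have "triple A c T B"
      using light by simp
    then show "triple ?J c T B"
      by (rule triple_pre) simp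
  next
    show "R rTau < R rA \<longleftrightarrow> \<tau> < line_count ps i j" if "?J R M os" for R M os
      using A[of R M os] that by (simp add: stored_def)
  qed (use heavy in simp_all)
  ultimately have "triple A (unless_heavy a b c) (length (cell a b @ [Load rA rAddr]) + Suc T) B"
    unfolding unless_heavy_def by (rule triple_seq)
  then show ?thesis
    by (simp add: cell_def eval_nat_numeral)
qed

text \<open>
  The time 35 consists of 18 instructions for the orientation, 1 for the collinearity test,
  5 for each of the three table look-ups, and 1 for the output.
\<close>

lemma triple_report_one:
  fixes ps :: "point list" and \<tau> i j k :: nat and acc :: "point set list"
  defines "n \<equiv> length ps"
  defines "A \<equiv> \<lambda>os0 R M os. stored ps \<tau> (n * n) R M \<and>
    R rI = real i \<and> R rJ = real j \<and> R rK = real k \<and> os = os0"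
  assumes lt: "i < n" "j < n" "k < n"
  shows "triple (A acc) test_and_report 35 (A (acc @ report ps \<tau> [(i, j, k)]))"
    (is "triple _ _ _ ?B")
proof -
  let ?out = "block [Output rXi rYi rXj rYj rXk rYk]"
  let ?light_jk = "unless_heavy rJ rK ?out"
  let ?light_ik = "unless_heavy rI rK ?light_jk"
  let ?light_ij = "unless_heavy rI rJ ?light_ik"
  let ?on = "on_line (ps ! i) (ps ! j) (ps ! k)"
  define Q where "Q = (\<lambda>R M os. A acc R M os \<and>
    (R rXi, R rYi) = ps ! i \<and> (R rXj, R rYj) = ps ! j \<and> (R rXk, R rYk) = ps ! k)"
  let ?Q = "\<lambda>R M os. Q R M os \<and> (R rA = R rB \<longleftrightarrow> ?on)"
  have "triple (A acc) (block orientation) (length orientation) ?Q"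
  proof (rule triple_block)
    fix s :: config assume s: "A acc (regs s) (mem s) (out s)"
    then have pre: "stored ps \<tau> (n * n) (regs s) (mem s)"
        "regs s rI = real i" "regs s rJ = real j" "regs s rK = real k"
      by (simp_all add: A_def)
    from run_orientation[OF pre lt[unfolded n_def]] obtain u where
      u: "run_block orientation s = Some u" "mem u = mem s" "out u = out s"
      "stored ps \<tau> (n * n) (regs u) (mem s)"
      "\<And>r. r \<in> {rI, rJ, rK, rCount} \<Longrightarrow> regs u r = regs s r"
      "(regs u rXi, regs u rYi) = ps ! i" "(regs u rXj, regs u rYj) = ps ! j"
      "(regs u rXk, regs u rYk) = ps ! k"
      "regs u rA = regs u rB \<longleftrightarrow> ?on"
      by blast
    then show "\<exists>s'. run_block orientation s = Some s' \<and> ?Q (regs s') (mem s') (out s')"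
      using s by (auto simp: A_def Q_def)
  qed
  moreover have "triple ?Q (unless (JumpEq rA rB) ?light_ij) (Suc (1 + 5 + 5 + 5)) ?B"
  proof (rule triple_unless[where b = "\<lambda>R. R rA = R rB" and \<phi> = ?on])
    have skip: "?B R M os" if "\<not> light_triple ps \<tau> (i, j, k)" "Q R M os" for R M os
      using that by (auto simp: Q_def A_def report_def)
    have out: "triple Q ?out 1 ?B"
      if "light_triple ps \<tau> (i, j, k)"
    proof -
      have "triple Q ?out (length [Output rXi rYi rXj rYj rXk rYk]) ?B"
        by (rule triple_block) (use that in \<open>auto simp: Q_def A_def report_def\<close>)
      then show ?thesis by simp
    qed
    assume "\<not> ?on"
    have 1: "triple Q ?light_jk (1 + 5) ?B"
      if "line_count ps i j \<le> \<tau>" "line_count ps i k \<le> \<tau>"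
      by (rule triple_unless_heavy[where ps = ps and \<tau> = \<tau> and i = j and j = k])
         (use lt that \<open>\<not> ?on\<close> out skip in \<open>simp_all add: n_def Q_def A_def stored_upd\<close>)
    have 2: "triple Q ?light_ik (1 + 5 + 5) ?B" if "line_count ps i j \<le> \<tau>"
      by (rule triple_unless_heavy[where ps = ps and \<tau> = \<tau> and i = i and j = k])
         (use lt that 1 skip in \<open>simp_all add: n_def Q_def A_def stored_upd\<close>)
    have "triple Q ?light_ij (1 + 5 + 5 + 5) ?B"
      by (rule triple_unless_heavy[where ps = ps and \<tau> = \<tau> and i = i and j = j])
         (use lt 2 skip in \<open>simp_all add: n_def Q_def A_def stored_upd\<close>)
    then show "triple ?Q ?light_ij (1 + 5 + 5 + 5) ?B"
      by (rule triple_pre) simp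
  qed (auto simp: Q_def A_def report_def)
  ultimately have "triple (A acc) test_and_report (length orientation + Suc (1 + 5 + 5 + 5)) ?B"
    unfolding test_and_report_def by (rule triple_seq)
  then show ?thesis
    by (simp add: length_orientation)
qed

text \<open>
  The two inner loops run only up to the index of the loop around them; for the time bound
  these lengths are replaced by \<open>n\<close>.
\<close>

lemma triple_report_phase:
  fixes ps :: "point list"
  defines "n \<equiv> length ps"
  shows "triple (\<lambda>R M os. stored ps \<tau> (n * n) R M \<and> os = []) report_phase
    (n * (n * (n * (35 + 3) + 2 + 3) + 2 + 3) + 2)
    (\<lambda>R M os. os = report ps \<tau> (triples_below n 0 0))"
proof -
  define A :: "nat \<Rightarrow> nat \<Rightarrow> nat \<Rightarrow> assertion" where
    "A = (\<lambda>i j k R M os. stored ps \<tau> (n * n) R M \<and>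
    R rI = real i \<and> R rJ = real j \<and> R rK = real k \<and>
    os = report ps \<tau> (triples_below i j k))"
  have one: "triple (A i j k) test_and_report 35
      (\<lambda>R M os. A i j (Suc k) (R(rK := R rK + R rOne)) M os)"
    if "i < n" "j < i" "k < j" for i j k
  proof (rule triple_post)
    show "triple (A i j k) test_and_report 35
      (\<lambda>R M os. stored ps \<tau> (n * n) R M \<and>
        R rI = real i \<and> R rJ = real j \<and> R rK = real k \<and>
        os = report ps \<tau> (triples_below i j k) @ report ps \<tau> [(i, j, k)])"
      using triple_report_one[of i ps j k \<tau> "report ps \<tau> (triples_below i j k)"] that
      by (simp add: A_def n_def)
  qed (auto simp: A_def stored_upd report_def, auto simp: stored_def)
  have col: "triple (\<lambda>R M os. A i j 0 (R(rK := 0)) M os)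
      (for_loop rK rJ test_and_report) (n * (35 + 3) + 2)
      (\<lambda>R M os. A i (Suc j) 0 (R(rJ := R rJ + R rOne, rK := 0)) M os)" if "i < n" "j < i" for i j
  proof (rule triple_mono)
    show "triple (\<lambda>R M os. A i j 0 (R(rK := 0)) M os)
      (for_loop rK rJ test_and_report) (j * (35 + 3) + 2)
      (\<lambda>R M os. A i (Suc j) 0 (R(rJ := R rJ + R rOne, rK := 0)) M os)"
      by (rule triple_for_loop[where I = "A i j" and n = j])
         (use one that in \<open>auto simp: A_def stored_def\<close>)
  qed (use that in simp)
  have row: "triple (\<lambda>R M os. A i 0 0 (R(rJ := 0, rK := 0)) M os)
      (for_loop rJ rI (for_loop rK rJ test_and_report))
      (n * (n * (35 + 3) + 2 + 3) + 2)
      (\<lambda>R M os. A (Suc i) 0 0 (R(rI := R rI + R rOne, rJ := 0, rK := 0)) M os)" if "i < n" for i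
  proof (rule triple_mono)
    show "triple (\<lambda>R M os. A i 0 0 (R(rJ := 0, rK := 0)) M os)
      (for_loop rJ rI (for_loop rK rJ test_and_report))
      (i * (n * (35 + 3) + 2 + 3) + 2)
      (\<lambda>R M os. A (Suc i) 0 0 (R(rI := R rI + R rOne, rJ := 0, rK := 0)) M os)"
      by (rule triple_for_loop[where I = "\<lambda>j R M os. A i j 0 (R(rK := 0)) M os" and n = i])
         (use col that in \<open>auto simp: A_def stored_def\<close>)
  qed (use that in simp)
  show ?thesis
    unfolding report_phase_def
    by (rule triple_for_loop[where I = "\<lambda>i R M os. A i 0 0 (R(rJ := 0, rK := 0)) M os" and n = n])
       (use row in \<open>auto simp: A_def stored_def n_def report_def\<close>)
qed

section \<open>Triangles and index triples\<close>

lemma on_line_iff_affine_hull: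
  assumes "p \<noteq> q"
  shows "r \<in> affine hull {p, q} \<longleftrightarrow> on_line p q r"
proof
  assume "r \<in> affine hull {p, q}"
  then show "on_line p q r"
    by (auto simp: affine_hull_2_alt on_line_def)
next
  assume r: "on_line p q r"
  have "\<exists>u. r = p + u *\<^sub>R (q - p)"
  proof (cases "fst q = fst p")
    case True
    with assms have "snd q \<noteq> snd p"
      by (simp add: prod_eq_iff)
    with True r show ?thesis
      by (intro exI[of _ "(snd r - snd p) / (snd q - snd p)"]) (auto simp: on_line_def prod_eq_iff)
  next
    case False
    with r have "(fst r - fst p) / (fst q - fst p) * (snd q - snd p) = snd r - snd p"
      by (simp add: on_line_def divide_eq_eq mult.commute)
    with False show ?thesis
      by (intro exI[of _ "(fst r - fst p) / (fst q - fst p)"]) (auto simp: prod_eq_iff)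
  qed
  then show "r \<in> affine hull {p, q}"
    by (auto simp: affine_hull_2_alt)
qed

lemma ordinary_line_iff:
  assumes "p \<in> X" "q \<in> X" "p \<noteq> q"
  shows "ordinary_line \<tau> X (affine hull {p, q}) \<longleftrightarrow> card {r \<in> X. on_line p q r} \<le> \<tau>"
proof -
  have "spanned_line X (affine hull {p, q})"
    unfolding spanned_line_def is_line_def
    using assms hull_subset[of "{p, q}" affine] by blast
  moreover have "X \<inter> affine hull {p, q} = {r \<in> X. on_line p q r}"
    using on_line_iff_affine_hull[OF assms(3)] by blast
  ultimately show ?thesis
    by (simp add: ordinary_line_def)
qed

lemma ordinary_triangle_iff:
  assumes "p \<in> X" "q \<in> X" "r \<in> X" "distinct [p, q, r]"
  shows "ordinary_triangle \<tau> X {p, q, r} \<longleftrightarrow> \<not> on_line p q r \<and>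
    card {x \<in> X. on_line p q x} \<le> \<tau> \<and> card {x \<in> X. on_line p r x} \<le> \<tau> \<and>
    card {x \<in> X. on_line q r x} \<le> \<tau>"
proof -
  have "collinear {p, q, r} \<longleftrightarrow> on_line p q r"
    using assms by (simp add: collinear_3_affine_hull on_line_iff_affine_hull)
  moreover have "ordinary_line \<tau> X (affine hull {b, a}) \<longleftrightarrow> ordinary_line \<tau> X (affine hull {a, b})"
    for a b
    by (simp add: insert_commute)
  ultimately show ?thesis
    using assms by (auto simp: ordinary_triangle_def ordinary_line_iff[symmetric])
qed

lemma line_count_eq_card:
  assumes "distinct ps"
  shows "line_count ps i j = card {x \<in> set ps. on_line (ps ! i) (ps ! j) x}"
proof -
  let ?K = "{k. k < length ps \<and> on_line (ps ! i) (ps ! j) (ps ! k)}"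
  have "(!) ps ` ?K = {x \<in> set ps. on_line (ps ! i) (ps ! j) x}"
    by (auto simp: in_set_conv_nth image_iff) metis
  moreover have "inj_on ((!) ps) ?K"
    using assms by (auto simp: inj_on_def nth_eq_iff_index_eq)
  ultimately show ?thesis
    using card_image[of "(!) ps" ?K] by (simp add: line_count_def)
qed

text \<open>
  The test of the machine is the geometric one. The strict order of the indices makes the three
  points distinct, so that their pairs do determine lines.
\<close>

lemma light_triple_iff:
  assumes "distinct ps" "k < j" "j < i" "i < length ps"
  shows "light_triple ps \<tau> (i, j, k) \<longleftrightarrow> ordinary_triangle \<tau> (set ps) (corners ps (i, j, k))"
  using assms by (simp add: ordinary_triangle_iff line_count_eq_card nth_eq_iff_index_eq)

lemma set_triples_below:
  "set (triples_below i j k) =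
     {(i', j', k'). k' < j' \<and> j' < i' \<and> i' < i} \<union>
     {(i', j', k'). k' < j' \<and> j' < j \<and> i' = i} \<union>
     {(i', j', k'). k' < k \<and> j' = j \<and> i' = i}"
  by (auto simp: triples_below_def image_iff)

text \<open>Each loop adds triples that are lexicographically above all earlier ones.\<close>

lemma distinct_triples_below: "distinct (triples_below n 0 0)"
proof -
  have k: "distinct (triples_below i j k)" if "distinct (triples_below i j 0)" for i j k
    using that by (induction k) (auto simp: set_triples_below)
  have j: "distinct (triples_below i j 0)" if "distinct (triples_below i 0 0)" for i j
    using that k by (induction j) auto
  show ?thesis
    using j by (induction n) auto
qed

lemma card_3_descending:
  fixes S :: "nat set"
  assumes "card S = 3"
  obtains i j k where "k < j" "j < i" "S = {i, j, k}"
proof -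
  obtain a b c where "S = {a, b, c}" "a \<noteq> b" "b \<noteq> c" "a \<noteq> c"
    using assms by (auto simp: card_3_iff)
  then show thesis
    using that[of a b c] that[of a c b] that[of b a c] that[of b c a] that[of c a b] that[of c b a]
    by (auto simp: insert_commute neq_iff)
qed

text \<open>
  Distinct points determine their set of indices, and an ordered triple is determined by its maximum,
  its minimum and the remaining element.
\<close>

lemma inj_on_corners:
  assumes "distinct ps"
  shows "inj_on (corners ps) {(i, j, k). k < j \<and> j < i \<and> i < length ps}"
proof (rule inj_onI)
  fix t t'
  assume "t \<in> {(i, j, k). k < j \<and> j < i \<and> i < length ps}"
    and "t' \<in> {(i, j, k). k < j \<and> j < i \<and> i < length ps}"
    and e: "corners ps t = corners ps t'"
  then obtain i j k i' j' k' where t: "t = (i, j, k)" "t' = (i', j', k')"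
    and o: "k < j" "j < i" "i < length ps" "k' < j'" "j' < i'" "i' < length ps"
    by blast
  have inj: "inj_on ((!) ps) {..<length ps}"
    using assms by (auto simp: inj_on_def nth_eq_iff_index_eq)
  have "(!) ps ` {i, j, k} = (!) ps ` {i', j', k'}"
    using e t by simp
  then have "{i, j, k} = {i', j', k'}"
    by (subst (asm) inj_on_image_eq_iff[OF inj]) (use o in auto)
  moreover have "Max {i, j, k} = i" "Max {i', j', k'} = i'" "Min {i, j, k} = k" "Min {i', j', k'} = k'"
    using o by (simp_all add: max_def min_def)
  ultimately have "i = i'" "k = k'" "j \<in> {i', j', k'}"
    by auto
  then show "t = t'"
    using o t by auto
qed

text \<open>
  Distinctness is the reason for visiting ordered triples only. Nothing is missed, as the
  three indices of a triangle can be sorted.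
\<close>

lemma report_correct:
  fixes ps :: "point list" and \<tau> :: nat
  assumes "distinct ps"
  defines "os \<equiv> report ps \<tau> (triples_below (length ps) 0 0)"
  shows "distinct os" "set os = {T. ordinary_triangle \<tau> (set ps) T}"
proof -
  show "distinct os"
    unfolding os_def report_def
    using inj_on_corners[OF assms(1)]
    by (auto simp: distinct_map distinct_triples_below set_triples_below intro: inj_on_subset)
  have "T \<in> set os" if T: "ordinary_triangle \<tau> (set ps) T" for T
  proof -
    let ?S = "{i. i < length ps \<and> ps ! i \<in> T}"
    have img: "(!) ps ` ?S = T"
      using T by (auto simp: ordinary_triangle_def in_set_conv_nth subset_iff image_iff) metis
    have "inj_on ((!) ps) ?S"
      using assms by (auto simp: inj_on_def nth_eq_iff_index_eq)
    then have "card ((!) ps ` ?S) = card ?S"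
      by (rule card_image)
    then have "card ?S = 3"
      unfolding img
      using T by (simp add: ordinary_triangle_def)
    then obtain i j k where ijk: "k < j" "j < i" "?S = {i, j, k}"
      by (rule card_3_descending)
    have "(!) ps ` {i, j, k} = T"
      using img unfolding ijk(3) .
    then have corners: "corners ps (i, j, k) = T"
      by simp
    have "i < length ps"
      using ijk(3) by blast
    then have "light_triple ps \<tau> (i, j, k)"
      using T corners light_triple_iff[OF assms(1) ijk(1,2)]
      by (simp del: corners.simps light_triple.simps)
    moreover have "(i, j, k) \<in> set (triples_below (length ps) 0 0)"
      using ijk \<open>i < length ps\<close> by (simp add: set_triples_below)
    ultimately show ?thesis
      using corners unfolding os_def report_def set_map set_filter by blast
  qed
  moreover have "ordinary_triangle \<tau> (set ps) T" if "T \<in> set os" for T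
    using that light_triple_iff[OF assms(1)]
    by (auto simp: os_def report_def set_triples_below simp del: corners.simps light_triple.simps)
  ultimately show "set os = {T. ordinary_triangle \<tau> (set ps) T}"
    by blast
qed

section \<open>The whole program\<close>

text \<open>
  The coefficient of \<open>n ^ 3\<close> is the cost of a round of the innermost loop, 24 in the count phase
  plus 38 in the report phase; the other terms come from the loops around them.
\<close>

lemma prog_halts:
  fixes ps :: "point list"
  defines "n \<equiv> length ps"
  shows "\<exists>t \<le> 62 * n ^ 3 + 15 * n ^ 2 + 10 * n + 6.
    halts_with (prog 0 @ [Halt]) ps \<tau> t (report ps \<tau> (triples_below n 0 0))"
proof -
  let ?A = "\<lambda>R M os. R rN = real n \<and> R rTau = real \<tau> \<and>
    (\<forall>i<n. M (2 * i) = fst (ps ! i) \<and> M (2 * i + 1) = snd (ps ! i)) \<and> os = []"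
  let ?B = "\<lambda>R M os. os = report ps \<tau> (triples_below n 0 0)"
  let ?T = "62 * n ^ 3 + 15 * n ^ 2 + 10 * n + 6"
  have "triple ?A (block [Const rOne 1, Add rBase rN rN]) (length [Const rOne 1, Add rBase rN rN])
      (\<lambda>R M os. stored ps \<tau> 0 R M \<and> os = [])"
    by (rule triple_block) (auto simp: set_reg_def stored_def n_def)
  from triple_seq[OF this triple_seq[OF triple_count_phase triple_report_phase]]
  have "triple ?A prog ?T ?B"
    unfolding prog_def n_def
    by (rule triple_mono) (simp add: algebra_simps power2_eq_square power3_eq_cube)
  then have "reaches (prog 0 @ [Halt]) ?T (init ps \<tau>) (length (prog 0)) ?B"
    by (rule tripleD[where pre = "[]" and post = "[Halt]"])
       (auto simp: init_def n_def)
  then show ?thesis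
    by (force simp: reaches_def halts_with_def halted_def)
qed

section \<open>The lower bound\<close>

lemma length_out_le_steps: "(step P ^^ t) s s' \<Longrightarrow> length (out s') \<le> length (out s) + t"
proof (induction t arbitrary: s')
  case (Suc t)
  then obtain u where u: "(step P ^^ t) s u" "step P u s'"
    by auto
  have "length (out s') \<le> length (out u) + 1"
    using u(2) unfolding step_def
    by (cases "P ! pc u") (auto simp: set_reg_def jump_if_def split: if_splits)
  with Suc.IH[OF u(1)] show ?case
    by simp
qed simp

definition parabola :: "nat \<Rightarrow> point" where
  "parabola i = (real i, real i ^ 2)"

text \<open>The determinant that decides collinearity is a Vandermonde determinant here.\<close>

lemma on_line_parabola_iff:
  "a \<noteq> b \<Longrightarrow> on_line (parabola a) (parabola b) (parabola c) \<longleftrightarrow> c = a \<or> c = b"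
proof -
  assume "a \<noteq> b"
  have "on_line (parabola a) (parabola b) (parabola c) \<longleftrightarrow>
     (real b - real a) * ((real c - real a) * (real c - real b)) = 0"
    by (simp only: on_line_def parabola_def fst_conv snd_conv) (algebra)
  then show ?thesis
    using \<open>a \<noteq> b\<close> by auto
qed

lemma inj_parabola: "inj parabola"
  by (auto simp: inj_def parabola_def)

lemma ordinary_triangle_parabola:
  assumes "T \<subseteq> parabola ` {..<n}" "card T = 3"
  shows "ordinary_triangle 2 (parabola ` {..<n}) T"
proof -
  let ?X = "parabola ` {..<n}"
  obtain p q r where "T = {p, q, r}" "p \<noteq> q" "q \<noteq> r" "p \<noteq> r"
    using assms(2) by (auto simp: card_3_iff)
  then obtain a b c where abc: "T = {parabola a, parabola b, parabola c}"
      "a < n" "b < n" "c < n" "a \<noteq> b" "b \<noteq> c" "a \<noteq> c"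
    using assms(1) by auto
  have two: "card {x \<in> ?X. on_line (parabola u) (parabola v) x} \<le> 2" if "u \<noteq> v" for u v
  proof -
    have "{x \<in> ?X. on_line (parabola u) (parabola v) x} \<subseteq> {parabola u, parabola v}"
      using on_line_parabola_iff[OF that] by auto
    then have "card {x \<in> ?X. on_line (parabola u) (parabola v) x} \<le> card {parabola u, parabola v}"
      by (intro card_mono) auto
    also have "\<dots> \<le> 2"
      by (simp add: card_insert_if)
    finally show ?thesis .
  qed
  show ?thesis
    unfolding abc(1)
    by (subst ordinary_triangle_iff)
       (use abc two on_line_parabola_iff inj_eq[OF inj_parabola] in auto)
qed

lemma parabola_lower_bound:
  assumes P: "reports_ordinary_triangles P"
  obtains X ps t os where "valid_input n X ps 2" "halts_with P ps 2 t os" "n choose 3 \<le> t"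
proof -
  let ?X = "parabola ` {..<n}"
  let ?ps = "map parabola [0..<n]"
  have inp: "valid_input n ?X ?ps 2"
    using inj_on_subset[OF inj_parabola subset_UNIV]
    by (auto simp: valid_input_def card_image distinct_map lessThan_atLeast0)
  then obtain t os where os: "halts_with P ?ps 2 t os" "set os = {T. ordinary_triangle 2 ?X T}"
    using P unfolding reports_ordinary_triangles_def by blast
  have "n choose 3 = card {T. T \<subseteq> ?X \<and> card T = 3}"
    using inp by (simp add: n_subsets valid_input_def)
  also have "\<dots> \<le> card (set os)"
    using ordinary_triangle_parabola[of _ n] os(2)
    by (intro card_mono[OF finite_set]) auto
  also have "\<dots> \<le> length os"
    by (rule card_length)
  also have "\<dots> \<le> t"
    using os(1) length_out_le_steps by (fastforce simp: halts_with_def init_def)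
  finally show thesis
    using that inp os(1) by blast
qed

theorem proposition4:
  "(\<exists>P. reports_ordinary_triangles P \<and>
        (\<exists>C::real. \<forall>n\<ge>1. \<forall>X ps \<tau>. valid_input n X ps \<tau> \<longrightarrow>
           (\<exists>t os. halts_with P ps \<tau> t os \<and> real t \<le> C * real n ^ 3))) \<and>
   (\<exists>c::real. c > 0 \<and> (\<exists>N. \<forall>P. reports_ordinary_triangles P \<longrightarrow>
        (\<forall>n\<ge>N. \<exists>X ps \<tau>. valid_input n X ps \<tau> \<and>
           (\<exists>t os. halts_with P ps \<tau> t os \<and> real t \<ge> c * real n ^ 3))))"
proof (intro conjI)
  \<comment> \<open>control leaves \<open>prog 0\<close> at its end, where the machine has to find \<open>Halt\<close>\<close>
  let ?P = "prog 0 @ [Halt]"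
  have "reports_ordinary_triangles ?P"
    using prog_halts report_correct unfolding reports_ordinary_triangles_def valid_input_def by blast
  moreover have "\<exists>t os. halts_with ?P ps \<tau> t os \<and> real t \<le> 93 * real n ^ 3"
    if "1 \<le> n" "valid_input n X ps \<tau>" for n X ps \<tau>
  proof -
    have "length ps = n"
      using that by (auto simp: valid_input_def distinct_card)
    then obtain t os where t: "halts_with ?P ps \<tau> t os" "t \<le> 62 * n ^ 3 + 15 * n ^ 2 + 10 * n + 6"
      using prog_halts[of ps \<tau>] by blast
    have "n ^ 2 \<le> n ^ 3" "n \<le> n ^ 3" "1 \<le> n ^ 3"
      using \<open>1 \<le> n\<close> by (auto intro: power_increasing self_le_power)
    then have "t \<le> 93 * n ^ 3"
      using t(2) by simp
    then have "real t \<le> real (93 * n ^ 3)"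
      by (rule of_nat_mono)
    then show ?thesis
      using t(1) by auto
  qed
  ultimately show "\<exists>P. reports_ordinary_triangles P \<and>
        (\<exists>C::real. \<forall>n\<ge>1. \<forall>X ps \<tau>. valid_input n X ps \<tau> \<longrightarrow>
           (\<exists>t os. halts_with P ps \<tau> t os \<and> real t \<le> C * real n ^ 3))"
    by blast
next
  have "\<exists>X ps \<tau>. valid_input n X ps \<tau> \<and>
      (\<exists>t os. halts_with P ps \<tau> t os \<and> real t \<ge> 1 / 27 * real n ^ 3)"
    if P: "reports_ordinary_triangles P" and "3 \<le> n" for P n
  proof -
    obtain X ps t os where t: "valid_input n X ps 2" "halts_with P ps 2 t os" "n choose 3 \<le> t"
      using parabola_lower_bound[OF P] by blast
    have "1 / 27 * real n ^ 3 = (real n / real 3) ^ 3"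
      by (simp add: power_divide)
    also have "\<dots> \<le> real (n choose 3)"
      using binomial_ge_n_over_k_pow_k[OF \<open>3 \<le> n\<close>, where ?'a = real] by simp
    also have "\<dots> \<le> real t"
      using t(3) by simp
    finally show ?thesis
      using t(1,2) by blast
  qed
  then show "\<exists>c::real. c > 0 \<and> (\<exists>N. \<forall>P. reports_ordinary_triangles P \<longrightarrow>
        (\<forall>n\<ge>N. \<exists>X ps \<tau>. valid_input n X ps \<tau> \<and>
           (\<exists>t os. halts_with P ps \<tau> t os \<and> real t \<ge> c * real n ^ 3)))"
    by (intro exI[of _ "1 / 27"] conjI exI[of _ 3]) auto
qed

end
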